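(* Let $C$ be a strict symmetric bimonoidal category whose multiplicative symmetry $\zeta^\otimes$ is the identity. Then the matrix construction $\mathsf{Mat}^C$, with multiplication the matrix tensor product $\boxtimes$, unit $1$, and symmetry $\beta$ described in the context, is a permutative 2-category.
   Context: A symmetric bimonoidal category is strict if its additive and multiplicative structures are both permutative (symmetric strict monoidal) categories and $\zeta^\oplus$, $\delta^l$, $\delta^r$, $\lambda^\bullet$, $\rho^\bullet$ are identities. Explicitly, it is a category $C$ with permutative structures $(\oplus,0)$, having identity symmetry $\zeta^\oplus$ (so $A\oplus B=B\oplus A$ naturally), and $(\otimes,1,\zeta^\otimes)$, such that, on objects and morphisms, $0\otimes A=0=A\otimes 0$, $A\otimes(B\oplus C)=(A\otimes B)\oplus(A\otimes C)$, $(A\oplus B)\otimes C=(A\otimes C)\oplus(B\otimes C)$, and such that $\zeta^\otimes_{A\oplus B,C}=\zeta^\otimes_{A,C}\oplus\zeta^\otimes_{B,C}$ and $\zeta^\otimes_{A,0}=1_0$. That $\zeta^\otimes$ is the identity means $A\otimes B=B\otimes A$ on objects and morphisms with each $\zeta^\otimes_{A,B}$ an identity morphism. $\mathsf{Mat}^C$ is the 2-category with objects the integers $m\ge0$; 1-cells (2-cells) $m\to n$ the $n\times m$ matrices of objects (morphisms) of $C$, with entrywise vertical composition; horizontal composition the matrix product $(BA)_{ki}=\bigoplus_j B_{kj}\otimes A_{ji}$; identity 1-cells the matrices $\mathbb 1^n$ with $1$ on the diagonal and $0$ elsewhere. The product $\boxtimes$ is $m\boxtimes n=mn$ on objects and,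 on 1- and 2-cells, $A\boxtimes B$ is the block matrix with $(j,i)$ block $(A_{ji}\otimes B_{lk})_{l,k}$. The 1-cell $\beta_{m,n}:mn\to nm$ is the permutation matrix (entries $1$ and $0$) of the permutation transposing the two indices. A permutative 2-category is a monoid $(M,\boxtimes,I)$ in the category of small 2-categories and 2-functors with the Cartesian product, together with a 2-natural isomorphism $\beta:\boxtimes\Rightarrow\boxtimes\circ\tau$, with $\tau$ the swap on $M\times M$, such that $\beta_{I,x}=1_x$, $\beta_{y,x}\beta_{x,y}=1$, and $\beta_{x,y\boxtimes z}=(1_y\boxtimes\beta_{x,z})(\beta_{x,y}\boxtimes 1_z)$ for all objects $x,y,z$. As usual, size conventions are such that $\mathsf{Mat}^C$ is a small 2-category (e.g. $C$ small). *)

theory Defs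
  imports "Jordan_Normal_Form.Matrix"
begin

section \<open>Categories and permutative categories\<close>

text \<open>All structures are carried by sets of elements of HOL types, hence are small. Composites are
  written in functional order: \<open>Comp C g f\<close> is \<open>g\<close> after \<open>f\<close>, and only its values on composable
  pairs matter.\<close>

record ('o, 'a) cat =
  Obj :: "'o set"
  Arr :: "'a set"
  Dom :: "'a \<Rightarrow> 'o"
  Cod :: "'a \<Rightarrow> 'o"
  Ide :: "'o \<Rightarrow> 'a"
  Comp :: "'a \<Rightarrow> 'a \<Rightarrow> 'a"

locale category =
  fixes C :: "('o, 'a) cat"
  assumes Dom_Obj: "f \<in> Arr C \<Longrightarrow> Dom C f \<in> Obj C"
    and Cod_Obj: "f \<in> Arr C \<Longrightarrow> Cod C f \<in> Obj C"
    and Ide_Arr: "A \<in> Obj C \<Longrightarrow> Ide C A \<in> Arr C"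
    and Dom_Ide: "A \<in> Obj C \<Longrightarrow> Dom C (Ide C A) = A"
    and Cod_Ide: "A \<in> Obj C \<Longrightarrow> Cod C (Ide C A) = A"
    and Comp_Arr: "\<lbrakk>f \<in> Arr C; g \<in> Arr C; Dom C g = Cod C f\<rbrakk> \<Longrightarrow> Comp C g f \<in> Arr C"
    and Dom_Comp: "\<lbrakk>f \<in> Arr C; g \<in> Arr C; Dom C g = Cod C f\<rbrakk> \<Longrightarrow> Dom C (Comp C g f) = Dom C f"
    and Cod_Comp: "\<lbrakk>f \<in> Arr C; g \<in> Arr C; Dom C g = Cod C f\<rbrakk> \<Longrightarrow> Cod C (Comp C g f) = Cod C g"
    and Comp_Ide: "f \<in> Arr C \<Longrightarrow> Comp C f (Ide C (Dom C f)) = f"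
    and Ide_Comp: "f \<in> Arr C \<Longrightarrow> Comp C (Ide C (Cod C f)) f = f"
    and Comp_assoc:
      "\<lbrakk>f \<in> Arr C; g \<in> Arr C; h \<in> Arr C; Dom C g = Cod C f; Dom C h = Cod C g\<rbrakk>
        \<Longrightarrow> Comp C h (Comp C g f) = Comp C (Comp C h g) f"

record ('o, 'a) perm_structure =
  ten_obj :: "'o \<Rightarrow> 'o \<Rightarrow> 'o"
  ten_arr :: "'a \<Rightarrow> 'a \<Rightarrow> 'a"
  unit_obj :: 'o
  symm :: "'o \<Rightarrow> 'o \<Rightarrow> 'a"

locale permutative_category = category C
  for C :: "('o, 'a) cat" +
  fixes P :: "('o, 'a) perm_structure"
  assumes ten_obj_Obj: "\<lbrakk>A \<in> Obj C; B \<in> Obj C\<rbrakk> \<Longrightarrow> ten_obj P A B \<in> Obj C"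
    and ten_arr_Arr: "\<lbrakk>f \<in> Arr C; g \<in> Arr C\<rbrakk> \<Longrightarrow> ten_arr P f g \<in> Arr C"
    and ten_Dom: "\<lbrakk>f \<in> Arr C; g \<in> Arr C\<rbrakk>
        \<Longrightarrow> Dom C (ten_arr P f g) = ten_obj P (Dom C f) (Dom C g)"
    and ten_Cod: "\<lbrakk>f \<in> Arr C; g \<in> Arr C\<rbrakk>
        \<Longrightarrow> Cod C (ten_arr P f g) = ten_obj P (Cod C f) (Cod C g)"
    and ten_Ide: "\<lbrakk>A \<in> Obj C; B \<in> Obj C\<rbrakk>
        \<Longrightarrow> ten_arr P (Ide C A) (Ide C B) = Ide C (ten_obj P A B)"
    and ten_Comp:
      "\<lbrakk>f \<in> Arr C; g \<in> Arr C; f' \<in> Arr C; g' \<in> Arr C; Dom C g = Cod C f; Dom C g' = Cod C f'\<rbrakk>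
        \<Longrightarrow> ten_arr P (Comp C g f) (Comp C g' f') = Comp C (ten_arr P g g') (ten_arr P f f')"
    and unit_Obj: "unit_obj P \<in> Obj C"
    and ten_obj_assoc: "\<lbrakk>A \<in> Obj C; B \<in> Obj C; D \<in> Obj C\<rbrakk>
        \<Longrightarrow> ten_obj P (ten_obj P A B) D = ten_obj P A (ten_obj P B D)"
    and ten_arr_assoc: "\<lbrakk>f \<in> Arr C; g \<in> Arr C; h \<in> Arr C\<rbrakk>
        \<Longrightarrow> ten_arr P (ten_arr P f g) h = ten_arr P f (ten_arr P g h)"
    and ten_obj_unit_left: "A \<in> Obj C \<Longrightarrow> ten_obj P (unit_obj P) A = A"
    and ten_obj_unit_right: "A \<in> Obj C \<Longrightarrow> ten_obj P A (unit_obj P) = A"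
    and ten_arr_unit_left: "f \<in> Arr C \<Longrightarrow> ten_arr P (Ide C (unit_obj P)) f = f"
    and ten_arr_unit_right: "f \<in> Arr C \<Longrightarrow> ten_arr P f (Ide C (unit_obj P)) = f"
    and symm_Arr: "\<lbrakk>A \<in> Obj C; B \<in> Obj C\<rbrakk> \<Longrightarrow> symm P A B \<in> Arr C"
    and symm_Dom: "\<lbrakk>A \<in> Obj C; B \<in> Obj C\<rbrakk> \<Longrightarrow> Dom C (symm P A B) = ten_obj P A B"
    and symm_Cod: "\<lbrakk>A \<in> Obj C; B \<in> Obj C\<rbrakk> \<Longrightarrow> Cod C (symm P A B) = ten_obj P B A"
    and symm_natural: "\<lbrakk>f \<in> Arr C; g \<in> Arr C\<rbrakk>
        \<Longrightarrow> Comp C (symm P (Cod C f) (Cod C g)) (ten_arr P f g)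
          = Comp C (ten_arr P g f) (symm P (Dom C f) (Dom C g))"
    and symm_unit: "A \<in> Obj C \<Longrightarrow> symm P (unit_obj P) A = Ide C A"
    and symm_symm: "\<lbrakk>A \<in> Obj C; B \<in> Obj C\<rbrakk>
        \<Longrightarrow> Comp C (symm P B A) (symm P A B) = Ide C (ten_obj P A B)"
    and symm_ten: "\<lbrakk>A \<in> Obj C; B \<in> Obj C; D \<in> Obj C\<rbrakk>
        \<Longrightarrow> symm P A (ten_obj P B D)
          = Comp C (ten_arr P (Ide C B) (symm P A D)) (ten_arr P (symm P A B) (Ide C D))"

definition identity_symmetry :: "('o, 'a) cat \<Rightarrow> ('o, 'a) perm_structure \<Rightarrow> bool" where
  "identity_symmetry C P \<longleftrightarrow>
    (\<forall>A\<in>Obj C. \<forall>B\<in>Obj C. ten_obj P A B = ten_obj P B A) \<and>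
    (\<forall>f\<in>Arr C. \<forall>g\<in>Arr C. ten_arr P f g = ten_arr P g f) \<and>
    (\<forall>A\<in>Obj C. \<forall>B\<in>Obj C. symm P A B = Ide C (ten_obj P A B))"

text \<open>\<open>S\<close> is the additive structure and \<open>P\<close> the multiplicative one. On morphisms, the object \<open>0\<close>
  stands for its identity.\<close>

locale strict_symmetric_bimonoidal_category =
  additive: permutative_category C S + multiplicative: permutative_category C P
  for C :: "('o, 'a) cat" and S P :: "('o, 'a) perm_structure" +
  assumes additive_symmetry: "identity_symmetry C S"
    and zero_ten_obj: "A \<in> Obj C \<Longrightarrow> ten_obj P (unit_obj S) A = unit_obj S"
    and ten_zero_obj: "A \<in> Obj C \<Longrightarrow> ten_obj P A (unit_obj S) = unit_obj S"
    and zero_ten_arr: "f \<in> Arr C \<Longrightarrow> ten_arr P (Ide C (unit_obj S)) f = Ide C (unit_obj S)"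
    and ten_zero_arr: "f \<in> Arr C \<Longrightarrow> ten_arr P f (Ide C (unit_obj S)) = Ide C (unit_obj S)"
    and left_distrib_obj: "\<lbrakk>A \<in> Obj C; B \<in> Obj C; D \<in> Obj C\<rbrakk>
        \<Longrightarrow> ten_obj P A (ten_obj S B D) = ten_obj S (ten_obj P A B) (ten_obj P A D)"
    and right_distrib_obj: "\<lbrakk>A \<in> Obj C; B \<in> Obj C; D \<in> Obj C\<rbrakk>
        \<Longrightarrow> ten_obj P (ten_obj S A B) D = ten_obj S (ten_obj P A D) (ten_obj P B D)"
    and left_distrib_arr: "\<lbrakk>f \<in> Arr C; g \<in> Arr C; h \<in> Arr C\<rbrakk>
        \<Longrightarrow> ten_arr P f (ten_arr S g h) = ten_arr S (ten_arr P f g) (ten_arr P f h)"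
    and right_distrib_arr: "\<lbrakk>f \<in> Arr C; g \<in> Arr C; h \<in> Arr C\<rbrakk>
        \<Longrightarrow> ten_arr P (ten_arr S f g) h = ten_arr S (ten_arr P f h) (ten_arr P g h)"
    and symm_add: "\<lbrakk>A \<in> Obj C; B \<in> Obj C; D \<in> Obj C\<rbrakk>
        \<Longrightarrow> symm P (ten_obj S A B) D = ten_arr S (symm P A D) (symm P B D)"
    and symm_zero: "A \<in> Obj C \<Longrightarrow> symm P A (unit_obj S) = Ide C (unit_obj S)"

section \<open>2-categories, 2-functors, 2-natural isomorphisms\<close>

record ('o, 'f, 'c) two_cat =
  Cell0 :: "'o set"
  Cell1 :: "'f set"
  Cell2 :: "'c set"
  src1 :: "'f \<Rightarrow> 'o"
  tgt1 :: "'f \<Rightarrow> 'o"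
  src2 :: "'c \<Rightarrow> 'f"
  tgt2 :: "'c \<Rightarrow> 'f"
  id1 :: "'o \<Rightarrow> 'f"
  id2 :: "'f \<Rightarrow> 'c"
  hcomp1 :: "'f \<Rightarrow> 'f \<Rightarrow> 'f"
  hcomp2 :: "'c \<Rightarrow> 'c \<Rightarrow> 'c"
  vcomp :: "'c \<Rightarrow> 'c \<Rightarrow> 'c"

definition one_cells_cat :: "('o, 'f, 'c) two_cat \<Rightarrow> ('o, 'f) cat" where
  "one_cells_cat M = \<lparr>Obj = Cell0 M, Arr = Cell1 M, Dom = src1 M, Cod = tgt1 M,
     Ide = id1 M, Comp = hcomp1 M\<rparr>"

definition vertical_cat :: "('o, 'f, 'c) two_cat \<Rightarrow> ('f, 'c) cat" where
  "vertical_cat M = \<lparr>Obj = Cell1 M, Arr = Cell2 M, Dom = src2 M, Cod = tgt2 M,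
     Ide = id2 M, Comp = vcomp M\<rparr>"

definition horizontal_cat :: "('o, 'f, 'c) two_cat \<Rightarrow> ('o, 'c) cat" where
  "horizontal_cat M = \<lparr>Obj = Cell0 M, Arr = Cell2 M,
     Dom = (\<lambda>a. src1 M (src2 M a)), Cod = (\<lambda>a. tgt1 M (src2 M a)),
     Ide = (\<lambda>x. id2 M (id1 M x)), Comp = hcomp2 M\<rparr>"

text \<open>A (strict) 2-category: the last four axioms say that \<open>(hcomp1, hcomp2)\<close> is a functor from
  composable pairs of the vertical hom-categories.\<close>

locale two_category =
  fixes M :: "('o, 'f, 'c) two_cat"
  assumes one_cells: "category (one_cells_cat M)"
    and vertical: "category (vertical_cat M)"
    and horizontal: "category (horizontal_cat M)"
    and src1_globular: "a \<in> Cell2 M \<Longrightarrow> src1 M (src2 M a) = src1 M (tgt2 M a)"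
    and tgt1_globular: "a \<in> Cell2 M \<Longrightarrow> tgt1 M (src2 M a) = tgt1 M (tgt2 M a)"
    and src2_hcomp2: "\<lbrakk>a \<in> Cell2 M; b \<in> Cell2 M; src1 M (src2 M b) = tgt1 M (src2 M a)\<rbrakk>
        \<Longrightarrow> src2 M (hcomp2 M b a) = hcomp1 M (src2 M b) (src2 M a)"
    and tgt2_hcomp2: "\<lbrakk>a \<in> Cell2 M; b \<in> Cell2 M; src1 M (src2 M b) = tgt1 M (src2 M a)\<rbrakk>
        \<Longrightarrow> tgt2 M (hcomp2 M b a) = hcomp1 M (tgt2 M b) (tgt2 M a)"
    and hcomp2_id2: "\<lbrakk>f \<in> Cell1 M; g \<in> Cell1 M; src1 M g = tgt1 M f\<rbrakk>
        \<Longrightarrow> hcomp2 M (id2 M g) (id2 M f) = id2 M (hcomp1 M g f)"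
    and interchange:
      "\<lbrakk>a \<in> Cell2 M; a' \<in> Cell2 M; b \<in> Cell2 M; b' \<in> Cell2 M;
        src2 M a' = tgt2 M a; src2 M b' = tgt2 M b; src1 M (src2 M b) = tgt1 M (src2 M a)\<rbrakk>
        \<Longrightarrow> hcomp2 M (vcomp M b' b) (vcomp M a' a) = vcomp M (hcomp2 M b' a') (hcomp2 M b a)"

record ('o, 'f, 'c, 'p, 'g, 'd) two_fun =
  map0 :: "'o \<Rightarrow> 'p"
  map1 :: "'f \<Rightarrow> 'g"
  map2 :: "'c \<Rightarrow> 'd"

locale two_functor = source: two_category M + target: two_category N
  for M :: "('o, 'f, 'c) two_cat" and N :: "('p, 'g, 'd) two_cat" +
  fixes F :: "('o, 'f, 'c, 'p, 'g, 'd) two_fun"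
  assumes map0_Cell0: "x \<in> Cell0 M \<Longrightarrow> map0 F x \<in> Cell0 N"
    and map1_Cell1: "f \<in> Cell1 M \<Longrightarrow> map1 F f \<in> Cell1 N"
    and map2_Cell2: "a \<in> Cell2 M \<Longrightarrow> map2 F a \<in> Cell2 N"
    and map_src1: "f \<in> Cell1 M \<Longrightarrow> src1 N (map1 F f) = map0 F (src1 M f)"
    and map_tgt1: "f \<in> Cell1 M \<Longrightarrow> tgt1 N (map1 F f) = map0 F (tgt1 M f)"
    and map_src2: "a \<in> Cell2 M \<Longrightarrow> src2 N (map2 F a) = map1 F (src2 M a)"
    and map_tgt2: "a \<in> Cell2 M \<Longrightarrow> tgt2 N (map2 F a) = map1 F (tgt2 M a)"
    and map_id1: "x \<in> Cell0 M \<Longrightarrow> map1 F (id1 M x) = id1 N (map0 F x)"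
    and map_id2: "f \<in> Cell1 M \<Longrightarrow> map2 F (id2 M f) = id2 N (map1 F f)"
    and map_hcomp1: "\<lbrakk>f \<in> Cell1 M; g \<in> Cell1 M; src1 M g = tgt1 M f\<rbrakk>
        \<Longrightarrow> map1 F (hcomp1 M g f) = hcomp1 N (map1 F g) (map1 F f)"
    and map_hcomp2: "\<lbrakk>a \<in> Cell2 M; b \<in> Cell2 M; src1 M (src2 M b) = tgt1 M (src2 M a)\<rbrakk>
        \<Longrightarrow> map2 F (hcomp2 M b a) = hcomp2 N (map2 F b) (map2 F a)"
    and map_vcomp: "\<lbrakk>a \<in> Cell2 M; b \<in> Cell2 M; src2 M b = tgt2 M a\<rbrakk>
        \<Longrightarrow> map2 F (vcomp M b a) = vcomp N (map2 F b) (map2 F a)"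

definition two_fun_eq_on ::
  "('o, 'f, 'c) two_cat \<Rightarrow> ('o, 'f, 'c, 'p, 'g, 'd) two_fun \<Rightarrow> ('o, 'f, 'c, 'p, 'g, 'd) two_fun \<Rightarrow> bool"
where
  "two_fun_eq_on M F G \<longleftrightarrow>
    (\<forall>x\<in>Cell0 M. map0 F x = map0 G x) \<and>
    (\<forall>f\<in>Cell1 M. map1 F f = map1 G f) \<and>
    (\<forall>a\<in>Cell2 M. map2 F a = map2 G a)"

definition two_fun_id :: "('o, 'f, 'c, 'o, 'f, 'c) two_fun" where
  "two_fun_id = \<lparr>map0 = id, map1 = id, map2 = id\<rparr>"

definition two_fun_comp ::
  "('p, 'g, 'd, 'q, 'h, 'e) two_fun \<Rightarrow> ('o, 'f, 'c, 'p, 'g, 'd) two_fun \<Rightarrow> ('o, 'f, 'c, 'q, 'h, 'e) two_fun"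
where
  "two_fun_comp G F = \<lparr>map0 = map0 G \<circ> map0 F, map1 = map1 G \<circ> map1 F, map2 = map2 G \<circ> map2 F\<rparr>"

text \<open>A 2-natural transformation is given by its components \<open>\<beta> x : F x \<rightarrow> G x\<close>; the last axiom is
  naturality with respect to 2-cells (equality of the two whiskerings).\<close>

locale two_natural_transformation = F: two_functor M N F + G: two_functor M N G
  for M :: "('o, 'f, 'c) two_cat" and N :: "('p, 'g, 'd) two_cat"
    and F G :: "('o, 'f, 'c, 'p, 'g, 'd) two_fun" +
  fixes \<beta> :: "'o \<Rightarrow> 'g"
  assumes component_Cell1: "x \<in> Cell0 M \<Longrightarrow> \<beta> x \<in> Cell1 N"
    and component_src: "x \<in> Cell0 M \<Longrightarrow> src1 N (\<beta> x) = map0 F x"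
    and component_tgt: "x \<in> Cell0 M \<Longrightarrow> tgt1 N (\<beta> x) = map0 G x"
    and natural1: "f \<in> Cell1 M
        \<Longrightarrow> hcomp1 N (map1 G f) (\<beta> (src1 M f)) = hcomp1 N (\<beta> (tgt1 M f)) (map1 F f)"
    and natural2: "a \<in> Cell2 M
        \<Longrightarrow> hcomp2 N (map2 G a) (id2 N (\<beta> (src1 M (src2 M a))))
          = hcomp2 N (id2 N (\<beta> (tgt1 M (src2 M a)))) (map2 F a)"

definition two_natural_isomorphism ::
  "('o, 'f, 'c) two_cat \<Rightarrow> ('p, 'g, 'd) two_cat \<Rightarrow> ('o, 'f, 'c, 'p, 'g, 'd) two_fun
    \<Rightarrow> ('o, 'f, 'c, 'p, 'g, 'd) two_fun \<Rightarrow> ('o \<Rightarrow> 'g) \<Rightarrow> bool"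
where
  "two_natural_isomorphism M N F G \<beta> \<longleftrightarrow>
    two_natural_transformation M N F G \<beta> \<and>
    (\<exists>\<gamma>. two_natural_transformation M N G F \<gamma> \<and>
      (\<forall>x\<in>Cell0 M. hcomp1 N (\<gamma> x) (\<beta> x) = id1 N (map0 F x) \<and>
                     hcomp1 N (\<beta> x) (\<gamma> x) = id1 N (map0 G x)))"

section \<open>Permutative 2-categories\<close>

definition two_cat_prod ::
  "('o, 'f, 'c) two_cat \<Rightarrow> ('p, 'g, 'd) two_cat \<Rightarrow> ('o \<times> 'p, 'f \<times> 'g, 'c \<times> 'd) two_cat"
where
  "two_cat_prod M N = \<lparr>
     Cell0 = Cell0 M \<times> Cell0 N, Cell1 = Cell1 M \<times> Cell1 N, Cell2 = Cell2 M \<times> Cell2 N,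
     src1 = map_prod (src1 M) (src1 N), tgt1 = map_prod (tgt1 M) (tgt1 N),
     src2 = map_prod (src2 M) (src2 N), tgt2 = map_prod (tgt2 M) (tgt2 N),
     id1 = map_prod (id1 M) (id1 N), id2 = map_prod (id2 M) (id2 N),
     hcomp1 = (\<lambda>(g, g') (f, f'). (hcomp1 M g f, hcomp1 N g' f')),
     hcomp2 = (\<lambda>(b, b') (a, a'). (hcomp2 M b a, hcomp2 N b' a')),
     vcomp = (\<lambda>(b, b') (a, a'). (vcomp M b a, vcomp N b' a'))\<rparr>"

definition two_fun_prod ::
  "('o, 'f, 'c, 'p, 'g, 'd) two_fun \<Rightarrow> ('o', 'f', 'c', 'p', 'g', 'd') two_fun
    \<Rightarrow> ('o \<times> 'o', 'f \<times> 'f', 'c \<times> 'c', 'p \<times> 'p', 'g \<times> 'g', 'd \<times> 'd') two_fun"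
where
  "two_fun_prod F G = \<lparr>map0 = map_prod (map0 F) (map0 G), map1 = map_prod (map1 F) (map1 G),
     map2 = map_prod (map2 F) (map2 G)\<rparr>"

definition two_fun_swap :: "('o \<times> 'p, 'f \<times> 'g, 'c \<times> 'd, 'p \<times> 'o, 'g \<times> 'f, 'd \<times> 'c) two_fun" where
  "two_fun_swap = \<lparr>map0 = prod.swap, map1 = prod.swap, map2 = prod.swap\<rparr>"

definition two_fun_assoc ::
  "(('o \<times> 'p) \<times> 'q, ('f \<times> 'g) \<times> 'h, ('c \<times> 'd) \<times> 'e,
    'o \<times> ('p \<times> 'q), 'f \<times> ('g \<times> 'h), 'c \<times> ('d \<times> 'e)) two_fun"
where
  "two_fun_assoc = \<lparr>map0 = (\<lambda>((x, y), z). (x, (y, z))), map1 = (\<lambda>((x, y), z). (x, (y, z))),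
     map2 = (\<lambda>((x, y), z). (x, (y, z)))\<rparr>"

text \<open>A 2-functor from the terminal 2-category to \<open>M\<close> is the same as an object \<open>I\<close>; its values on
  cells are \<open>I\<close>, \<open>1\<^sub>I\<close> and the identity 2-cell of \<open>1\<^sub>I\<close>. The following are the 2-functors \<open>(I, -)\<close>
  and \<open>(-, I)\<close> from \<open>M\<close> to \<open>M \<times> M\<close>.\<close>

definition two_fun_pair_left ::
  "('o, 'f, 'c) two_cat \<Rightarrow> 'o \<Rightarrow> ('o, 'f, 'c, 'o \<times> 'o, 'f \<times> 'f, 'c \<times> 'c) two_fun" where
  "two_fun_pair_left M I = \<lparr>map0 = (\<lambda>x. (I, x)), map1 = (\<lambda>f. (id1 M I, f)),
     map2 = (\<lambda>a. (id2 M (id1 M I), a))\<rparr>"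

definition two_fun_pair_right ::
  "('o, 'f, 'c) two_cat \<Rightarrow> 'o \<Rightarrow> ('o, 'f, 'c, 'o \<times> 'o, 'f \<times> 'f, 'c \<times> 'c) two_fun" where
  "two_fun_pair_right M I = \<lparr>map0 = (\<lambda>x. (x, I)), map1 = (\<lambda>f. (f, id1 M I)),
     map2 = (\<lambda>a. (a, id2 M (id1 M I)))\<rparr>"

locale monoid_two_category = two_category M
  for M :: "('o, 'f, 'c) two_cat" +
  fixes T :: "('o \<times> 'o, 'f \<times> 'f, 'c \<times> 'c, 'o, 'f, 'c) two_fun"
    and I :: 'o
  assumes product_two_functor: "two_functor (two_cat_prod M M) M T"
    and unit_Cell0: "I \<in> Cell0 M"
    and product_assoc: "two_fun_eq_on (two_cat_prod (two_cat_prod M M) M)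
      (two_fun_comp T (two_fun_prod T two_fun_id))
      (two_fun_comp T (two_fun_comp (two_fun_prod two_fun_id T) two_fun_assoc))"
    and product_unit_left: "two_fun_eq_on M (two_fun_comp T (two_fun_pair_left M I)) two_fun_id"
    and product_unit_right: "two_fun_eq_on M (two_fun_comp T (two_fun_pair_right M I)) two_fun_id"

locale permutative_two_category = monoid_two_category M T I
  for M :: "('o, 'f, 'c) two_cat"
    and T :: "('o \<times> 'o, 'f \<times> 'f, 'c \<times> 'c, 'o, 'f, 'c) two_fun"
    and I :: 'o +
  fixes \<beta> :: "'o \<times> 'o \<Rightarrow> 'f"
  assumes symmetry_two_natural:
      "two_natural_isomorphism (two_cat_prod M M) M T (two_fun_comp T two_fun_swap) \<beta>"
    and symmetry_unit: "x \<in> Cell0 M \<Longrightarrow> \<beta> (I, x) = id1 M x"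
    and symmetry_symmetry: "\<lbrakk>x \<in> Cell0 M; y \<in> Cell0 M\<rbrakk>
        \<Longrightarrow> hcomp1 M (\<beta> (y, x)) (\<beta> (x, y)) = id1 M (map0 T (x, y))"
    and symmetry_product: "\<lbrakk>x \<in> Cell0 M; y \<in> Cell0 M; z \<in> Cell0 M\<rbrakk>
        \<Longrightarrow> \<beta> (x, map0 T (y, z))
          = hcomp1 M (map1 T (id1 M y, \<beta> (x, z))) (map1 T (\<beta> (x, y), id1 M z))"

section \<open>The matrix construction\<close>

text \<open>Matrices are those of the matrix library, with indices starting from \<open>0\<close>. A matrix remembers its
  dimensions, also when one of them is \<open>0\<close>, so a 1-cell \<open>m \<rightarrow> n\<close> is a matrix with \<open>n\<close> rows and
  \<open>m\<close> columns. The operations of the library require a semiring type class, so they are restated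
  here for arbitrary addition, multiplication, zero and one; they are used for matrices of objects
  and for matrices of morphisms.\<close>

primrec ordered_sum :: "('x \<Rightarrow> 'x \<Rightarrow> 'x) \<Rightarrow> 'x \<Rightarrow> (nat \<Rightarrow> 'x) \<Rightarrow> nat \<Rightarrow> 'x" where
  "ordered_sum plus_op zero_el f 0 = zero_el"
| "ordered_sum plus_op zero_el f (Suc n) = plus_op (ordered_sum plus_op zero_el f n) (f n)"

definition matrix_product ::
  "('x \<Rightarrow> 'x \<Rightarrow> 'x) \<Rightarrow> 'x \<Rightarrow> ('x \<Rightarrow> 'x \<Rightarrow> 'x) \<Rightarrow> 'x mat \<Rightarrow> 'x mat \<Rightarrow> 'x mat" where
  "matrix_product plus_op zero_el times_op B A = mat (dim_row B) (dim_col A)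
     (\<lambda>(k, i). ordered_sum plus_op zero_el (\<lambda>j. times_op (B $$ (k, j)) (A $$ (j, i))) (dim_row A))"

definition identity_matrix :: "'x \<Rightarrow> 'x \<Rightarrow> nat \<Rightarrow> 'x mat" where
  "identity_matrix zero_el one_el n = mat n n (\<lambda>(j, i). if j = i then one_el else zero_el)"

text \<open>Blocks are laid out lexicographically: the pair \<open>(j, l)\<close> is the row index \<open>j * dim_row B + l\<close>,
  and similarly for columns.\<close>

definition matrix_tensor :: "('x \<Rightarrow> 'x \<Rightarrow> 'x) \<Rightarrow> 'x mat \<Rightarrow> 'x mat \<Rightarrow> 'x mat" where
  "matrix_tensor times_op A B = mat (dim_row A * dim_row B) (dim_col A * dim_col B)
     (\<lambda>(r, s). times_op (A $$ (r div dim_row B, s div dim_col B)) (B $$ (r mod dim_row B, s mod dim_col B)))"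

text \<open>The column \<open>i * n + k\<close> (with \<open>i < m\<close>, \<open>k < n\<close>) has its \<open>one_el\<close> in row \<open>k * m + i\<close>.\<close>

definition transposition_matrix :: "'x \<Rightarrow> 'x \<Rightarrow> nat \<Rightarrow> nat \<Rightarrow> 'x mat" where
  "transposition_matrix zero_el one_el m n = mat (n * m) (m * n)
     (\<lambda>(r, s). if r div m = s mod n \<and> r mod m = s div n then one_el else zero_el)"

definition Mat ::
  "('o, 'a) cat \<Rightarrow> ('o, 'a) perm_structure \<Rightarrow> ('o, 'a) perm_structure \<Rightarrow> (nat, 'o mat, 'a mat) two_cat"
where
  "Mat C S P = \<lparr>
     Cell0 = UNIV,
     Cell1 = {A. elements_mat A \<subseteq> Obj C},
     Cell2 = {a. elements_mat a \<subseteq> Arr C},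
     src1 = dim_col,
     tgt1 = dim_row,
     src2 = map_mat (Dom C),
     tgt2 = map_mat (Cod C),
     id1 = identity_matrix (unit_obj S) (unit_obj P),
     id2 = map_mat (Ide C),
     hcomp1 = matrix_product (ten_obj S) (unit_obj S) (ten_obj P),
     hcomp2 = matrix_product (ten_arr S) (Ide C (unit_obj S)) (ten_arr P),
     vcomp = (\<lambda>b a. mat (dim_row a) (dim_col a) (\<lambda>ij. Comp C (b $$ ij) (a $$ ij)))\<rparr>"

definition Mat_tensor ::
  "('o, 'a) perm_structure
    \<Rightarrow> (nat \<times> nat, 'o mat \<times> 'o mat, 'a mat \<times> 'a mat, nat, 'o mat, 'a mat) two_fun"
where
  "Mat_tensor P = \<lparr>
     map0 = (\<lambda>(m, n). m * n),
     map1 = (\<lambda>(A, B). matrix_tensor (ten_obj P) A B),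
     map2 = (\<lambda>(a, b). matrix_tensor (ten_arr P) a b)\<rparr>"

definition Mat_symmetry ::
  "('o, 'a) perm_structure \<Rightarrow> ('o, 'a) perm_structure \<Rightarrow> nat \<times> nat \<Rightarrow> 'o mat" where
  "Mat_symmetry S P = (\<lambda>(m, n). transposition_matrix (unit_obj S) (unit_obj P) m n)"

end

theory Submission
  imports Defs
begin

text \<open>Strictness turns every coherence isomorphism but the two symmetries into an identity, and the
  additive symmetry is an identity as well. Hence the objects of \<open>C\<close> form a semiring under \<open>\<oplus>\<close>
  and \<open>\<otimes>\<close>, the morphisms of \<open>C\<close> form another one (its zero and one are the identities of
  \<open>0\<close> and \<open>1\<close>), and domain, codomain and identities are semiring homomorphisms between the two.
  If the multiplicative symmetry is an identity too, both semirings are commutative. All equations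
  between 1-cells or between 2-cells that involve only the matrix product and the tensor product are
  therefore identities of ordinary matrix algebra, and are proved once for a semiring carried by a
  set, then used for both semirings; sources, targets and identity 2-cells are compatible with these
  operations because a homomorphism may be applied entrywise. What remains is the compatibility with
  vertical composition. For the matrix product this is the functoriality of \<open>\<oplus>\<close> and \<open>\<otimes>\<close>,
  which lets a sum of composites be rewritten as a composite of sums (\<open>Comp_osum\<close>,
  \<open>mprod_vertical_composite\<close>); for the tensor product it is the functoriality of \<open>\<otimes>\<close> alone.

  Commutativity of the multiplication enters in two places. The tensor product respects the matrix
  product (\<open>mtensor_mprod\<close>) because
  \<open>(B\<^sub>k\<^sub>j \<otimes> A\<^sub>j\<^sub>i) \<otimes> (B' \<otimes> A') = (B\<^sub>k\<^sub>j \<otimes> B') \<otimes> (A\<^sub>j\<^sub>i \<otimes> A')\<close>, and the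
  permutation matrix that transposes two indices intertwines \<open>A \<boxtimes> B\<close> with \<open>B \<boxtimes> A\<close>
  (\<open>transposition_natural\<close>) because corresponding entries of these two matrices differ by the order
  of the factors. The axioms on the symmetry alone concern only \<open>0\<close>-\<open>1\<close> matrices of functions between
  finite index sets, whose product is composition of functions; they become equations
  between functions of a pair or triple of indices (\<open>transposition_product\<close>).\<close>

section \<open>Matrices over a semiring carried by a set\<close>

text \<open>The laws are required on a carrier only, since the operations of a category are unspecified
  outside its sets of objects and morphisms.\<close>

locale semiring_on =
  fixes R :: "'x set"
    and add :: "'x \<Rightarrow> 'x \<Rightarrow> 'x" (infixl \<open>\<boxplus>\<close> 65)
    and zero :: 'x
    and mul :: "'x \<Rightarrow> 'x \<Rightarrow> 'x" (infixl \<open>\<boxdot>\<close> 70)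
    and one :: 'x
  assumes zero_closed [simp]: "zero \<in> R"
    and one_closed [simp]: "one \<in> R"
    and add_closed [simp]: "\<lbrakk>a \<in> R; b \<in> R\<rbrakk> \<Longrightarrow> a \<boxplus> b \<in> R"
    and mul_closed [simp]: "\<lbrakk>a \<in> R; b \<in> R\<rbrakk> \<Longrightarrow> a \<boxdot> b \<in> R"
    and add_assoc: "\<lbrakk>a \<in> R; b \<in> R; c \<in> R\<rbrakk> \<Longrightarrow> (a \<boxplus> b) \<boxplus> c = a \<boxplus> (b \<boxplus> c)"
    and add_comm: "\<lbrakk>a \<in> R; b \<in> R\<rbrakk> \<Longrightarrow> a \<boxplus> b = b \<boxplus> a"
    and zero_add [simp]: "a \<in> R \<Longrightarrow> zero \<boxplus> a = a"
    and mul_assoc: "\<lbrakk>a \<in> R; b \<in> R; c \<in> R\<rbrakk> \<Longrightarrow> (a \<boxdot> b) \<boxdot> c = a \<boxdot> (b \<boxdot> c)"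
    and one_mul [simp]: "a \<in> R \<Longrightarrow> one \<boxdot> a = a"
    and mul_one [simp]: "a \<in> R \<Longrightarrow> a \<boxdot> one = a"
    and zero_mul [simp]: "a \<in> R \<Longrightarrow> zero \<boxdot> a = zero"
    and mul_zero [simp]: "a \<in> R \<Longrightarrow> a \<boxdot> zero = zero"
    and distrib_left: "\<lbrakk>a \<in> R; b \<in> R; c \<in> R\<rbrakk> \<Longrightarrow> a \<boxdot> (b \<boxplus> c) = (a \<boxdot> b) \<boxplus> (a \<boxdot> c)"
    and distrib_right: "\<lbrakk>a \<in> R; b \<in> R; c \<in> R\<rbrakk> \<Longrightarrow> (a \<boxplus> b) \<boxdot> c = (a \<boxdot> c) \<boxplus> (b \<boxdot> c)"

lemma ordered_sum_cong:
  assumes "\<And>j. j < n \<Longrightarrow> f j = g j"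
  shows "ordered_sum pl z f n = ordered_sum pl z g n"
  using assms by (induction n) auto

lemma elements_mat_subset_iff:
  "elements_mat A \<subseteq> R \<longleftrightarrow> (\<forall>i<dim_row A. \<forall>j<dim_col A. A $$ (i, j) \<in> R)"
  unfolding elements_mat_def by fastforce

lemma pair_index_bound:
  fixes i k m n :: nat
  assumes "i < m" "k < n"
  shows "i * n + k < m * n"
proof -
  have "i * n + k < Suc i * n" using assms by simp
  also have "\<dots> \<le> m * n" using assms by (intro mult_right_mono) auto
  finally show ?thesis .
qed

lemma pair_index_div_mod:
  fixes i k n :: nat
  assumes "k < n"
  shows "(i * n + k) div n = i" "(i * n + k) mod n = k"
  using assms by simp_all

lemma div_mod_bound:
  fixes r m n :: nat
  assumes "r < m * n"
  shows "r div n < m" "r mod n < n"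
proof -
  have "0 < n" using assms by (cases n) auto
  then show "r div n < m" "r mod n < n"
    using assms by (auto simp: div_less_iff_less_mult)
qed

lemma dim_matrix_product [simp]:
  "dim_row (matrix_product pl z tm B A) = dim_row B"
  "dim_col (matrix_product pl z tm B A) = dim_col A"
  by (simp_all add: matrix_product_def)

lemma dim_matrix_tensor [simp]:
  "dim_row (matrix_tensor tm A B) = dim_row A * dim_row B"
  "dim_col (matrix_tensor tm A B) = dim_col A * dim_col B"
  by (simp_all add: matrix_tensor_def)

lemma dim_identity_matrix [simp]:
  "dim_row (identity_matrix z u n) = n" "dim_col (identity_matrix z u n) = n"
  by (simp_all add: identity_matrix_def)

lemma dim_transposition_matrix [simp]:
  "dim_row (transposition_matrix z u m n) = n * m" "dim_col (transposition_matrix z u m n) = m * n"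
  by (simp_all add: transposition_matrix_def)

context semiring_on
begin

abbreviation osum :: "(nat \<Rightarrow> 'x) \<Rightarrow> nat \<Rightarrow> 'x" where
  "osum \<equiv> ordered_sum (\<boxplus>) zero"

abbreviation mprod :: "'x mat \<Rightarrow> 'x mat \<Rightarrow> 'x mat" where
  "mprod \<equiv> matrix_product (\<boxplus>) zero (\<boxdot>)"

abbreviation mtensor :: "'x mat \<Rightarrow> 'x mat \<Rightarrow> 'x mat" where
  "mtensor \<equiv> matrix_tensor (\<boxdot>)"

abbreviation matrices :: "'x mat set" where
  "matrices \<equiv> {A. elements_mat A \<subseteq> R}"

lemma entry_closed:
  "\<lbrakk>A \<in> matrices; i < dim_row A; j < dim_col A\<rbrakk> \<Longrightarrow> A $$ (i, j) \<in> R"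
  by (simp add: elements_mat_subset_iff)

lemma add_zero [simp]: "a \<in> R \<Longrightarrow> a \<boxplus> zero = a"
  using add_comm zero_add by simp

lemma osum_closed:
  assumes "\<And>j. j < n \<Longrightarrow> f j \<in> R"
  shows "osum f n \<in> R"
  using assms by (induction n) auto

lemma osum_zero: "osum (\<lambda>j. zero) n = zero"
  by (induction n) auto

lemma osum_add:
  assumes "\<And>j. j < n \<Longrightarrow> f j \<in> R" "\<And>j. j < n \<Longrightarrow> g j \<in> R"
  shows "osum (\<lambda>j. f j \<boxplus> g j) n = osum f n \<boxplus> osum g n"
  using assms
proof (induction n)
  case (Suc n)
  have c: "osum f n \<in> R" "osum g n \<in> R" "f n \<in> R" "g n \<in> R"
    using Suc.prems by (auto intro: osum_closed)
  have "osum g n \<boxplus> (f n \<boxplus> g n) = f n \<boxplus> (osum g n \<boxplus> g n)"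
    using c by (metis add_assoc add_comm)
  then show ?case using Suc c by (simp add: add_assoc)
qed simp

lemma mul_osum:
  assumes "a \<in> R" "\<And>j. j < n \<Longrightarrow> f j \<in> R"
  shows "a \<boxdot> osum f n = osum (\<lambda>j. a \<boxdot> f j) n"
  using assms by (induction n) (auto simp: distrib_left osum_closed)

lemma osum_mul:
  assumes "a \<in> R" "\<And>j. j < n \<Longrightarrow> f j \<in> R"
  shows "osum f n \<boxdot> a = osum (\<lambda>j. f j \<boxdot> a) n"
  using assms by (induction n) (auto simp: distrib_right osum_closed)

lemma osum_swap:
  assumes "\<And>i j. \<lbrakk>i < m; j < n\<rbrakk> \<Longrightarrow> f i j \<in> R"
  shows "osum (\<lambda>i. osum (f i) n) m = osum (\<lambda>j. osum (\<lambda>i. f i j) m) n"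
  using assms
proof (induction m)
  case (Suc m)
  show ?case
    using Suc by (simp add: osum_add osum_closed)
qed (simp add: osum_zero)

lemma osum_split:
  assumes "\<And>j. j < m + n \<Longrightarrow> f j \<in> R"
  shows "osum f (m + n) = osum f m \<boxplus> osum (\<lambda>k. f (m + k)) n"
  using assms
proof (induction n)
  case (Suc n)
  then show ?case by (simp add: osum_closed add_assoc)
qed (simp add: osum_closed)

text \<open>Summing over the indices of a tensor product, laid out lexicographically, amounts to a double
  sum over the indices of the factors.\<close>

lemma osum_times:
  assumes "\<And>j. j < m * n \<Longrightarrow> f j \<in> R"
  shows "osum f (m * n) = osum (\<lambda>i. osum (\<lambda>k. f (i * n + k)) n) m"
  using assms
proof (induction m)
  case (Suc m)
  have "osum f (m * n + n) = osum f (m * n) \<boxplus> osum (\<lambda>k. f (m * n + k)) n"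
    by (rule osum_split) (use Suc.prems in \<open>simp add: add.commute\<close>)
  then show ?case using Suc by (simp add: add.commute)
qed simp

lemma osum_single:
  assumes "i < n" "f i \<in> R" "\<And>j. \<lbrakk>j < n; j \<noteq> i\<rbrakk> \<Longrightarrow> f j = zero"
  shows "osum f n = f i"
  using assms
proof (induction n)
  case (Suc n)
  show ?case
  proof (cases "i = n")
    case True
    have "osum f n = osum (\<lambda>j. zero) n"
      by (rule ordered_sum_cong) (use Suc.prems True in auto)
    then show ?thesis using Suc.prems True by (simp add: osum_zero)
  next
    case False
    then show ?thesis using Suc by simp
  qed
qed simp

subsection \<open>Matrix product\<close>

lemma mprod_closed:
  assumes "B \<in> matrices" "A \<in> matrices" "dim_col B = dim_row A"
  shows "mprod B A \<in> matrices"
  using assms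
  by (auto simp: elements_mat_subset_iff matrix_product_def intro!: osum_closed)

lemma mprod_assoc:
  assumes "A \<in> matrices" "B \<in> matrices" "D \<in> matrices"
    and "dim_col B = dim_row A" "dim_col D = dim_row B"
  shows "mprod D (mprod B A) = mprod (mprod D B) A"
proof (rule eq_matI)
  fix l i
  assume "l < dim_row (mprod (mprod D B) A)" "i < dim_col (mprod (mprod D B) A)"
  then have li: "l < dim_row D" "i < dim_col A" by (auto simp: matrix_product_def)
  note cl = entry_closed[OF assms(1)] entry_closed[OF assms(2)] entry_closed[OF assms(3)]
  have "mprod D (mprod B A) $$ (l, i)
      = osum (\<lambda>k. D $$ (l, k) \<boxdot> osum (\<lambda>j. B $$ (k, j) \<boxdot> A $$ (j, i)) (dim_row A)) (dim_row B)"
    using li by (auto simp: matrix_product_def intro!: ordered_sum_cong)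
  also have "\<dots> = osum (\<lambda>k. osum (\<lambda>j. D $$ (l, k) \<boxdot> (B $$ (k, j) \<boxdot> A $$ (j, i))) (dim_row A)) (dim_row B)"
    using li assms(4,5) by (intro ordered_sum_cong mul_osum) (auto simp: cl)
  also have "\<dots> = osum (\<lambda>j. osum (\<lambda>k. D $$ (l, k) \<boxdot> (B $$ (k, j) \<boxdot> A $$ (j, i))) (dim_row B)) (dim_row A)"
    using li assms(4,5) by (intro osum_swap) (auto simp: cl)
  also have "\<dots> = osum (\<lambda>j. osum (\<lambda>k. (D $$ (l, k) \<boxdot> B $$ (k, j)) \<boxdot> A $$ (j, i)) (dim_row B)) (dim_row A)"
    using li assms(4,5) by (intro ordered_sum_cong mul_assoc[symmetric]) (auto simp: cl)
  also have "\<dots> = osum (\<lambda>j. osum (\<lambda>k. D $$ (l, k) \<boxdot> B $$ (k, j)) (dim_row B) \<boxdot> A $$ (j, i)) (dim_row A)"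
    using li assms(4,5) by (intro ordered_sum_cong osum_mul[symmetric]) (auto simp: cl)
  also have "\<dots> = mprod (mprod D B) A $$ (l, i)"
    using li assms(4) by (auto simp: matrix_product_def intro!: ordered_sum_cong)
  finally show "mprod D (mprod B A) $$ (l, i) = mprod (mprod D B) A $$ (l, i)" .
qed (auto simp: matrix_product_def)

subsection \<open>Matrices of functions between index sets\<close>

text \<open>The matrix of the linear map that sends the basis vector \<open>s\<close> to the basis vector \<open>\<sigma> s\<close>.
  Identities and index transpositions are of this form, and the form is stable under products and
  tensor products, so equations between them reduce to equations between functions.\<close>

definition function_matrix :: "nat \<Rightarrow> nat \<Rightarrow> (nat \<Rightarrow> nat) \<Rightarrow> 'x mat" where
  "function_matrix n m \<sigma> = mat n m (\<lambda>(r, s). if r = \<sigma> s then one else zero)"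

lemma function_matrix_closed: "function_matrix n m \<sigma> \<in> matrices"
  by (auto simp: elements_mat_subset_iff function_matrix_def)

lemma function_matrix_cong:
  assumes "\<And>s. s < m \<Longrightarrow> \<sigma> s = \<tau> s"
  shows "function_matrix n m \<sigma> = function_matrix n m \<tau>"
  using assms by (auto simp: function_matrix_def)

lemma identity_matrix_eq: "identity_matrix zero one n = function_matrix n n (\<lambda>s. s)"
  by (simp add: identity_matrix_def function_matrix_def)

lemma identity_matrix_closed: "identity_matrix zero one n \<in> matrices"
  unfolding identity_matrix_eq by (rule function_matrix_closed)

lemma mprod_function_matrix_right:
  assumes "A \<in> matrices" "\<And>s. s < m \<Longrightarrow> \<sigma> s < dim_col A"
  shows "mprod A (function_matrix (dim_col A) m \<sigma>)
    = mat (dim_row A) m (\<lambda>(r, s). A $$ (r, \<sigma> s))"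
proof (rule eq_matI)
  fix r s
  assume "r < dim_row (mat (dim_row A) m (\<lambda>(r, s). A $$ (r, \<sigma> s)))"
    "s < dim_col (mat (dim_row A) m (\<lambda>(r, s). A $$ (r, \<sigma> s)))"
  then have rs: "r < dim_row A" "s < m" by auto
  have "mprod A (function_matrix (dim_col A) m \<sigma>) $$ (r, s)
      = osum (\<lambda>j. A $$ (r, j) \<boxdot> function_matrix (dim_col A) m \<sigma> $$ (j, s)) (dim_col A)"
    using rs by (simp add: matrix_product_def function_matrix_def)
  also have "\<dots> = A $$ (r, \<sigma> s) \<boxdot> function_matrix (dim_col A) m \<sigma> $$ (\<sigma> s, s)"
    by (rule osum_single) (use rs assms in \<open>auto simp: function_matrix_def entry_closed\<close>)
  finally show "mprod A (function_matrix (dim_col A) m \<sigma>) $$ (r, s)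
      = mat (dim_row A) m (\<lambda>(r, s). A $$ (r, \<sigma> s)) $$ (r, s)"
    using rs assms by (simp add: function_matrix_def entry_closed)
qed (auto simp: matrix_product_def function_matrix_def)

text \<open>Multiplication on the left sends row \<open>s\<close> of \<open>A\<close> to row \<open>\<sigma> s\<close>. For this to be a
  rearrangement of the rows, \<open>\<sigma>\<close> needs the inverse \<open>\<tau>\<close>; otherwise rows would be added up or
  missed.\<close>

lemma mprod_function_matrix_left:
  assumes "A \<in> matrices"
    and "\<And>r. r < n \<Longrightarrow> \<tau> r < dim_row A"
    and "\<And>r s. \<lbrakk>r < n; s < dim_row A\<rbrakk> \<Longrightarrow> r = \<sigma> s \<longleftrightarrow> s = \<tau> r"
  shows "mprod (function_matrix n (dim_row A) \<sigma>) A
    = mat n (dim_col A) (\<lambda>(r, s). A $$ (\<tau> r, s))"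
proof (rule eq_matI)
  fix r s
  assume "r < dim_row (mat n (dim_col A) (\<lambda>(r, s). A $$ (\<tau> r, s)))"
    "s < dim_col (mat n (dim_col A) (\<lambda>(r, s). A $$ (\<tau> r, s)))"
  then have rs: "r < n" "s < dim_col A" by auto
  have "mprod (function_matrix n (dim_row A) \<sigma>) A $$ (r, s)
      = osum (\<lambda>j. function_matrix n (dim_row A) \<sigma> $$ (r, j) \<boxdot> A $$ (j, s)) (dim_row A)"
    using rs by (simp add: matrix_product_def function_matrix_def)
  also have "\<dots> = function_matrix n (dim_row A) \<sigma> $$ (r, \<tau> r) \<boxdot> A $$ (\<tau> r, s)"
    by (rule osum_single) (use rs assms in \<open>auto simp: function_matrix_def entry_closed\<close>)
  finally show "mprod (function_matrix n (dim_row A) \<sigma>) A $$ (r, s)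
      = mat n (dim_col A) (\<lambda>(r, s). A $$ (\<tau> r, s)) $$ (r, s)"
    using rs assms(1) assms(2)[of r] assms(3)[of r "\<tau> r"]
    by (simp add: function_matrix_def entry_closed)
qed (auto simp: matrix_product_def function_matrix_def)

lemma mprod_identity:
  assumes "A \<in> matrices"
  shows "mprod A (identity_matrix zero one (dim_col A)) = A"
    and "mprod (identity_matrix zero one (dim_row A)) A = A"
  unfolding identity_matrix_eq
  using mprod_function_matrix_right[OF assms, of "dim_col A" "\<lambda>s. s"]
    mprod_function_matrix_left[OF assms, of "dim_row A" "\<lambda>s. s" "\<lambda>s. s", OF _ eq_commute]
  by (auto intro!: eq_matI)

lemma mprod_function_matrices:
  assumes "\<And>s. s < m \<Longrightarrow> \<tau> s < n"
  shows "mprod (function_matrix k n \<sigma>) (function_matrix n m \<tau>) = function_matrix k m (\<lambda>s. \<sigma> (\<tau> s))"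
  using mprod_function_matrix_right[OF function_matrix_closed, of m \<tau> k n \<sigma>] assms
  by (auto simp: function_matrix_def intro!: eq_matI)

lemma mtensor_function_matrices:
  assumes "\<And>s. s < m' \<Longrightarrow> \<tau> s < n'"
  shows "mtensor (function_matrix n m \<sigma>) (function_matrix n' m' \<tau>)
    = function_matrix (n * n') (m * m') (\<lambda>s. \<sigma> (s div m') * n' + \<tau> (s mod m'))"
proof (rule eq_matI)
  fix r s
  assume "r < dim_row (function_matrix (n * n') (m * m') (\<lambda>s. \<sigma> (s div m') * n' + \<tau> (s mod m')))"
    "s < dim_col (function_matrix (n * n') (m * m') (\<lambda>s. \<sigma> (s div m') * n' + \<tau> (s mod m')))"
  then have rs: "r < n * n'" "s < m * m'" by (auto simp: function_matrix_def)
  have b: "r div n' < n" "r mod n' < n'" "s div m' < m" "s mod m' < m'"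
    using rs div_mod_bound by auto
  have "r = \<sigma> (s div m') * n' + \<tau> (s mod m')
      \<longleftrightarrow> r div n' = \<sigma> (s div m') \<and> r mod n' = \<tau> (s mod m')"
    using assms[OF b(4)] by (metis div_mult_mod_eq div_mult_self3 div_less add.commute add_0
        mod_mult_self3 mod_less gr_implies_not0)
  then show "mtensor (function_matrix n m \<sigma>) (function_matrix n' m' \<tau>) $$ (r, s)
      = function_matrix (n * n') (m * m') (\<lambda>s. \<sigma> (s div m') * n' + \<tau> (s mod m')) $$ (r, s)"
    using rs b by (auto simp: matrix_tensor_def function_matrix_def)
qed (auto simp: matrix_tensor_def function_matrix_def)

lemma mtensor_identity:
  "mtensor (identity_matrix zero one m) (identity_matrix zero one n) = identity_matrix zero one (m * n)"
  unfolding identity_matrix_eq by (simp add: mtensor_function_matrices)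

subsection \<open>Tensor product\<close>

lemma mtensor_closed:
  assumes "A \<in> matrices" "B \<in> matrices"
  shows "mtensor A B \<in> matrices"
  using assms
  by (auto simp: elements_mat_subset_iff matrix_tensor_def div_mod_bound)

text \<open>Both sides address their entries by the same three digits of a number in mixed radix; they
  only split off these digits in a different order.\<close>

lemma mtensor_assoc:
  assumes "A \<in> matrices" "B \<in> matrices" "D \<in> matrices"
  shows "mtensor (mtensor A B) D = mtensor A (mtensor B D)"
proof (rule eq_matI)
  fix r s
  assume "r < dim_row (mtensor A (mtensor B D))" "s < dim_col (mtensor A (mtensor B D))"
  then have rs: "r < dim_row A * dim_row B * dim_row D" "s < dim_col A * dim_col B * dim_col D"
    by (auto simp: matrix_tensor_def mult.assoc)
  note b = div_mod_bound[OF rs(1)] div_mod_bound[OF rs(2)]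
  note b' = div_mod_bound[OF b(1)] div_mod_bound[OF b(3)]
  have m: "r mod (dim_row B * dim_row D) < dim_row B * dim_row D"
    "s mod (dim_col B * dim_col D) < dim_col B * dim_col D"
    using b b' by auto
  have d: "t div (p * q) = t div q div p" "t mod (p * q) div q = t div q mod p"
    "t mod (p * q) mod q = t mod q" if "t mod q < q" for t p q :: nat
    using that
    by (simp_all add: div_mult2_eq mod_mult2_eq mult.commute[of p])
  show "mtensor (mtensor A B) D $$ (r, s) = mtensor A (mtensor B D) $$ (r, s)"
    using rs b b' m assms
    by (simp add: matrix_tensor_def d mult.assoc[symmetric] mul_assoc entry_closed)
qed (auto simp: matrix_tensor_def)

lemma mtensor_unit:
  assumes "A \<in> matrices"
  shows "mtensor (identity_matrix zero one 1) A = A"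
    and "mtensor A (identity_matrix zero one 1) = A"
  using assms
  by (auto simp: matrix_tensor_def identity_matrix_def entry_closed intro!: eq_matI)

end

section \<open>Transposing a pair of indices\<close>

text \<open>The number \<open>i * n + k\<close>, where \<open>i < m\<close> and \<open>k < n\<close>, encodes the pair \<open>(i, k)\<close>; its image
  \<open>k * m + i\<close> encodes \<open>(k, i)\<close>.\<close>

definition transpose_index :: "nat \<Rightarrow> nat \<Rightarrow> nat \<Rightarrow> nat" where
  "transpose_index m n s = s mod n * m + s div n"

lemma transpose_index_pair: "k < n \<Longrightarrow> transpose_index m n (i * n + k) = k * m + i"
  by (simp add: transpose_index_def)

lemma transpose_index_bound: "s < m * n \<Longrightarrow> transpose_index m n s < n * m"
  by (simp add: transpose_index_def pair_index_bound div_mod_bound)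

lemma transpose_index_div_mod:
  assumes "s < m * n"
  shows "transpose_index m n s div m = s mod n" "transpose_index m n s mod m = s div n"
  using div_mod_bound[OF assms] by (simp_all add: transpose_index_def)

lemma transpose_index_involutive: "s < m * n \<Longrightarrow> transpose_index n m (transpose_index m n s) = s"
  using transpose_index_div_mod[of s m n] by (simp add: transpose_index_def[of n m])

lemma transpose_index_inverse_iff:
  assumes "r < n * m" "s < m * n"
  shows "r = transpose_index m n s \<longleftrightarrow> s = transpose_index n m r"
  using assms transpose_index_involutive by metis

text \<open>For the triple \<open>(i, j, k)\<close> encoded by \<open>s\<close>, the number \<open>t\<close> encodes \<open>(j, i, k)\<close>, and exchanging
  its last two entries gives \<open>(j, k, i)\<close>. This is also what moving \<open>i\<close> past the pair \<open>(j, k)\<close>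
  gives.\<close>

lemma transpose_index_product:
  assumes "s < x * (y * z)"
  defines "t \<equiv> transpose_index x y (s div z) * z + s mod z"
  shows "transpose_index x (y * z) s
    = t div (x * z) * (z * x) + transpose_index x z (t mod (x * z))"
proof -
  have s: "s < (x * y) * z" using assms by (simp add: mult.assoc)
  define i j k where "i = s div z div y" and "j = s div z mod y" and "k = s mod z"
  have b: "i < x" "j < y" "k < z"
    using div_mod_bound[OF s] div_mod_bound[OF div_mod_bound(1)[OF s]]
    by (auto simp: i_def j_def k_def)
  have s_eq: "s = i * (y * z) + (j * z + k)"
  proof -
    have "s = (i * y + j) * z + k" by (simp add: i_def j_def k_def)
    then show ?thesis by (simp add: algebra_simps)
  qed
  have "s div z = i * y + j" by (simp add: i_def j_def)
  then have "t = (j * x + i) * z + k"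
    using b by (simp only: t_def transpose_index_pair k_def)
  then have t: "t = j * (x * z) + (i * z + k)"
    by (simp add: algebra_simps)
  have "transpose_index x (y * z) s = (j * z + k) * x + i"
    unfolding s_eq using b by (intro transpose_index_pair pair_index_bound)
  moreover have "t div (x * z) = j" "t mod (x * z) = i * z + k"
    unfolding t using pair_index_div_mod[OF pair_index_bound[OF b(1,3)]] by blast+
  ultimately show ?thesis
    using transpose_index_pair[OF b(3), of x i] by (simp add: algebra_simps)
qed

context semiring_on
begin

abbreviation transposition :: "nat \<Rightarrow> nat \<Rightarrow> 'x mat" where
  "transposition \<equiv> transposition_matrix zero one"

lemma transposition_eq:
  "transposition m n = function_matrix (n * m) (m * n) (transpose_index m n)"
proof (rule eq_matI)
  fix r s
  assume "r < dim_row (function_matrix (n * m) (m * n) (transpose_index m n))"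
    "s < dim_col (function_matrix (n * m) (m * n) (transpose_index m n))"
  then have rs: "r < n * m" "s < m * n" by (auto simp: function_matrix_def)
  have "r div m = s mod n \<and> r mod m = s div n \<longleftrightarrow> r = transpose_index m n s"
    using transpose_index_div_mod[OF rs(2)] by (metis div_mult_mod_eq)
  then show "transposition m n $$ (r, s)
      = function_matrix (n * m) (m * n) (transpose_index m n) $$ (r, s)"
    using rs by (simp add: transposition_matrix_def function_matrix_def)
qed (auto simp: transposition_matrix_def function_matrix_def)

lemma transposition_closed: "transposition m n \<in> matrices"
  unfolding transposition_eq by (rule function_matrix_closed)

lemma transposition_unit: "transposition 1 n = identity_matrix zero one n"
  unfolding transposition_eq identity_matrix_eq
  by (auto simp: transpose_index_def intro!: function_matrix_cong)

lemma transposition_involutive: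
  "mprod (transposition n m) (transposition m n) = identity_matrix zero one (m * n)"
  unfolding transposition_eq identity_matrix_eq
  by (subst mprod_function_matrices)
    (auto simp: transpose_index_bound transpose_index_involutive intro!: function_matrix_cong)

lemma transposition_product:
  "transposition x (y * z)
    = mprod (mtensor (identity_matrix zero one y) (transposition x z))
        (mtensor (transposition x y) (identity_matrix zero one z))"
proof -
  have l: "mtensor (identity_matrix zero one y) (transposition x z)
      = function_matrix (y * (z * x)) (y * (x * z))
          (\<lambda>s. s div (x * z) * (z * x) + transpose_index x z (s mod (x * z)))"
    unfolding transposition_eq identity_matrix_eq
    by (rule mtensor_function_matrices) (rule transpose_index_bound)
  have r: "mtensor (transposition x y) (identity_matrix zero one z)
      = function_matrix (y * (x * z)) (x * (y * z))
          (\<lambda>s. transpose_index x y (s div z) * z + s mod z)"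
    unfolding transposition_eq identity_matrix_eq
    by (subst mtensor_function_matrices) (simp_all add: mult.assoc)
  have bound: "transpose_index x y (s div z) * z + s mod z < y * (x * z)"
    if "s < x * (y * z)" for s
  proof -
    have s: "s < (x * y) * z" using that by (simp add: mult.assoc)
    show ?thesis
      using pair_index_bound[OF transpose_index_bound[OF div_mod_bound(1)[OF s]] div_mod_bound(2)[OF s]]
      by (simp add: mult.assoc)
  qed
  show ?thesis
    unfolding l r
    by (subst mprod_function_matrices, erule bound)
      (auto simp: transposition_eq transpose_index_product mult_ac intro!: function_matrix_cong)
qed

end

section \<open>Commutative multiplication\<close>

locale comm_semiring_on = semiring_on +
  assumes mul_comm: "\<lbrakk>a \<in> R; b \<in> R\<rbrakk> \<Longrightarrow> mul a b = mul b a"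
begin

lemma osum_mul_osum:
  assumes "\<And>i. i < m \<Longrightarrow> f i \<in> R" "\<And>j. j < n \<Longrightarrow> g j \<in> R"
  shows "osum f m \<boxdot> osum g n = osum (\<lambda>i. osum (\<lambda>j. f i \<boxdot> g j) n) m"
proof -
  have "osum f m \<boxdot> osum g n = osum (\<lambda>i. f i \<boxdot> osum g n) m"
    using assms by (intro osum_mul osum_closed)
  also have "\<dots> = osum (\<lambda>i. osum (\<lambda>j. f i \<boxdot> g j) n) m"
    using assms by (intro ordered_sum_cong mul_osum)
  finally show ?thesis .
qed

lemma mul_interchange:
  assumes "a \<in> R" "b \<in> R" "c \<in> R" "d \<in> R"
  shows "(a \<boxdot> b) \<boxdot> (c \<boxdot> d) = (a \<boxdot> c) \<boxdot> (b \<boxdot> d)"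
  using assms by (metis mul_assoc mul_closed mul_comm)

text \<open>A product of two sums is a double sum, in which the middle factors are exchanged; this is
  where commutativity is needed.\<close>

lemma mtensor_mprod:
  assumes "A \<in> matrices" "B \<in> matrices" "A' \<in> matrices" "B' \<in> matrices"
    and dims: "dim_col B = dim_row A" "dim_col B' = dim_row A'"
  shows "mtensor (mprod B A) (mprod B' A') = mprod (mtensor B B') (mtensor A A')"
proof (rule eq_matI)
  let ?n = "dim_row A" and ?n' = "dim_row A'"
  fix r s
  assume "r < dim_row (mprod (mtensor B B') (mtensor A A'))"
    "s < dim_col (mprod (mtensor B B') (mtensor A A'))"
  then have rs: "r < dim_row B * dim_row B'" "s < dim_col A * dim_col A'"
    by (auto simp: matrix_product_def matrix_tensor_def)
  define r1 r2 s1 s2 where "r1 = r div dim_row B'" "r2 = r mod dim_row B'"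
    and "s1 = s div dim_col A'" "s2 = s mod dim_col A'"
  have b: "r1 < dim_row B" "r2 < dim_row B'" "s1 < dim_col A" "s2 < dim_col A'"
    using div_mod_bound[OF rs(1)] div_mod_bound[OF rs(2)] by (auto simp: r1_r2_def s1_s2_def)
  note cl = entry_closed[OF assms(1)] entry_closed[OF assms(2)]
    entry_closed[OF assms(3)] entry_closed[OF assms(4)]
  have "mtensor (mprod B A) (mprod B' A') $$ (r, s)
      = osum (\<lambda>j. B $$ (r1, j) \<boxdot> A $$ (j, s1)) ?n \<boxdot> osum (\<lambda>j. B' $$ (r2, j) \<boxdot> A' $$ (j, s2)) ?n'"
    using rs b by (simp add: matrix_product_def matrix_tensor_def r1_r2_def s1_s2_def)
  also have "\<dots> = osum (\<lambda>j. osum (\<lambda>j'.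
      (B $$ (r1, j) \<boxdot> A $$ (j, s1)) \<boxdot> (B' $$ (r2, j') \<boxdot> A' $$ (j', s2))) ?n') ?n"
    using b dims by (intro osum_mul_osum) (auto simp: cl)
  also have "\<dots> = osum (\<lambda>j. osum (\<lambda>j'.
      (B $$ (r1, j) \<boxdot> B' $$ (r2, j')) \<boxdot> (A $$ (j, s1) \<boxdot> A' $$ (j', s2))) ?n') ?n"
    using b dims by (intro ordered_sum_cong mul_interchange) (auto simp: cl)
  also have "\<dots> = osum (\<lambda>j. osum (\<lambda>j'.
      mtensor B B' $$ (r, j * ?n' + j') \<boxdot> mtensor A A' $$ (j * ?n' + j', s)) ?n') ?n"
    using rs b dims
    by (intro ordered_sum_cong) (simp add: matrix_tensor_def pair_index_bound r1_r2_def s1_s2_def)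
  also have "\<dots> = osum (\<lambda>t. mtensor B B' $$ (r, t) \<boxdot> mtensor A A' $$ (t, s)) (?n * ?n')"
    using rs dims mtensor_closed[OF assms(2,4)] mtensor_closed[OF assms(1,3)]
    by (intro osum_times[symmetric] mul_closed entry_closed) (auto simp: matrix_tensor_def)
  also have "\<dots> = mprod (mtensor B B') (mtensor A A') $$ (r, s)"
    using rs by (simp add: matrix_product_def matrix_tensor_def)
  finally show "mtensor (mprod B A) (mprod B' A') $$ (r, s)
      = mprod (mtensor B B') (mtensor A A') $$ (r, s)" .
qed (auto simp: matrix_product_def matrix_tensor_def)

text \<open>On the left the columns, on the right the rows are permuted. In both cases the entry at
  \<open>(r, s)\<close>, with \<open>r\<close> encoding \<open>(l, j)\<close> and \<open>s\<close> encoding \<open>(i, k)\<close>, is the product of \<open>A\<^sub>j\<^sub>i\<close> and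
  \<open>B\<^sub>l\<^sub>k\<close>, but with the factors in opposite orders.\<close>

lemma transposition_natural:
  assumes "A \<in> matrices" "B \<in> matrices"
  shows "mprod (mtensor B A) (transposition (dim_col A) (dim_col B))
    = mprod (transposition (dim_row A) (dim_row B)) (mtensor A B)"
proof -
  let ?m = "dim_col A" and ?n = "dim_col B" and ?m' = "dim_row A" and ?n' = "dim_row B"
  have dims: "dim_row (mtensor B A) = ?n' * ?m'" "dim_col (mtensor B A) = ?n * ?m"
    "dim_row (mtensor A B) = ?m' * ?n'" "dim_col (mtensor A B) = ?m * ?n"
    by (auto simp: matrix_tensor_def)
  have "mprod (mtensor B A) (transposition ?m ?n)
      = mat (?n' * ?m') (?m * ?n) (\<lambda>(r, s). mtensor B A $$ (r, transpose_index ?m ?n s))"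
    using mprod_function_matrix_right[OF mtensor_closed[OF assms(2,1)], of "?m * ?n" "transpose_index ?m ?n"]
    by (simp add: transposition_eq dims transpose_index_bound)
  also have "\<dots> = mat (?n' * ?m') (?m * ?n) (\<lambda>(r, s). mtensor A B $$ (transpose_index ?n' ?m' r, s))"
  proof (rule eq_matI)
    fix r s
    assume "r < dim_row (mat (?n' * ?m') (?m * ?n) (\<lambda>(r, s). mtensor A B $$ (transpose_index ?n' ?m' r, s)))"
      "s < dim_col (mat (?n' * ?m') (?m * ?n) (\<lambda>(r, s). mtensor A B $$ (transpose_index ?n' ?m' r, s)))"
    then have rs: "r < ?n' * ?m'" "s < ?m * ?n" by auto
    show "mat (?n' * ?m') (?m * ?n) (\<lambda>(r, s). mtensor B A $$ (r, transpose_index ?m ?n s)) $$ (r, s)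
        = mat (?n' * ?m') (?m * ?n) (\<lambda>(r, s). mtensor A B $$ (transpose_index ?n' ?m' r, s)) $$ (r, s)"
      using rs assms div_mod_bound[OF rs(1)] div_mod_bound[OF rs(2)]
      by (simp add: matrix_tensor_def transpose_index_bound transpose_index_div_mod
          mul_comm entry_closed)
  qed auto
  also have "\<dots> = mprod (transposition ?m' ?n') (mtensor A B)"
    using mprod_function_matrix_left[OF mtensor_closed[OF assms], of "?n' * ?m'"
        "transpose_index ?n' ?m'" "transpose_index ?m' ?n'"]
    by (simp add: transposition_eq dims transpose_index_bound transpose_index_inverse_iff)
  finally show ?thesis .
qed

end

section \<open>Entrywise application of homomorphisms\<close>

locale semiring_on_hom =
  source: semiring_on R add zero mul one + target: semiring_on R' add' zero' mul' one'
  for R :: "'x set" and add zero mul one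
    and R' :: "'y set" and add' zero' mul' one' +
  fixes h :: "'x \<Rightarrow> 'y"
  assumes hom_closed: "a \<in> R \<Longrightarrow> h a \<in> R'"
    and hom_zero: "h zero = zero'"
    and hom_one: "h one = one'"
    and hom_add: "\<lbrakk>a \<in> R; b \<in> R\<rbrakk> \<Longrightarrow> h (add a b) = add' (h a) (h b)"
    and hom_mul: "\<lbrakk>a \<in> R; b \<in> R\<rbrakk> \<Longrightarrow> h (mul a b) = mul' (h a) (h b)"
begin

lemma hom_osum:
  assumes "\<And>j. j < n \<Longrightarrow> f j \<in> R"
  shows "h (source.osum f n) = target.osum (\<lambda>j. h (f j)) n"
  using assms by (induction n) (auto simp: hom_zero hom_add source.osum_closed)

lemma map_mat_mprod:
  assumes "A \<in> source.matrices" "B \<in> source.matrices" "dim_col B = dim_row A"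
  shows "map_mat h (source.mprod B A) = target.mprod (map_mat h B) (map_mat h A)"
proof (rule eq_matI)
  fix r s
  assume "r < dim_row (target.mprod (map_mat h B) (map_mat h A))"
    "s < dim_col (target.mprod (map_mat h B) (map_mat h A))"
  then have rs: "r < dim_row B" "s < dim_col A" by (auto simp: matrix_product_def)
  note cl = source.entry_closed[OF assms(1)] source.entry_closed[OF assms(2)]
  show "map_mat h (source.mprod B A) $$ (r, s)
      = target.mprod (map_mat h B) (map_mat h A) $$ (r, s)"
    using rs assms(3)
    by (auto simp: matrix_product_def hom_osum hom_mul cl intro!: ordered_sum_cong)
qed (auto simp: matrix_product_def)

lemma map_mat_mtensor:
  assumes "A \<in> source.matrices" "B \<in> source.matrices"
  shows "map_mat h (source.mtensor A B) = target.mtensor (map_mat h A) (map_mat h B)"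
  using assms
  by (auto simp: matrix_tensor_def div_mod_bound hom_mul source.entry_closed intro!: eq_matI)

lemma map_mat_function_matrix:
  "map_mat h (source.function_matrix n m \<sigma>) = target.function_matrix n m \<sigma>"
  by (auto simp: source.function_matrix_def target.function_matrix_def hom_zero hom_one
      intro!: eq_matI)

lemma map_mat_identity: "map_mat h (identity_matrix zero one n) = identity_matrix zero' one' n"
  by (simp add: source.identity_matrix_eq target.identity_matrix_eq map_mat_function_matrix)

lemma map_mat_transposition: "map_mat h (source.transposition m n) = target.transposition m n"
  by (simp add: source.transposition_eq target.transposition_eq map_mat_function_matrix)

end

section \<open>Products and composites of 2-functors\<close>

definition cat_prod :: "('o, 'a) cat \<Rightarrow> ('p, 'b) cat \<Rightarrow> ('o \<times> 'p, 'a \<times> 'b) cat" where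
  "cat_prod C D = \<lparr>Obj = Obj C \<times> Obj D, Arr = Arr C \<times> Arr D,
     Dom = map_prod (Dom C) (Dom D), Cod = map_prod (Cod C) (Cod D),
     Ide = map_prod (Ide C) (Ide D), Comp = (\<lambda>(g, g') (f, f'). (Comp C g f, Comp D g' f'))\<rparr>"

lemma category_cat_prod:
  assumes "category C" "category D"
  shows "category (cat_prod C D)"
proof -
  interpret C: category C by fact
  interpret D: category D by fact
  show ?thesis
    by unfold_locales
      (auto simp: cat_prod_def C.Dom_Obj C.Cod_Obj C.Ide_Arr C.Dom_Ide C.Cod_Ide C.Comp_Arr
        C.Dom_Comp C.Cod_Comp C.Comp_Ide C.Ide_Comp C.Comp_assoc
        D.Dom_Obj D.Cod_Obj D.Ide_Arr D.Dom_Ide D.Cod_Ide D.Comp_Arr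
        D.Dom_Comp D.Cod_Comp D.Comp_Ide D.Ide_Comp D.Comp_assoc)
qed

lemma two_category_prod:
  assumes "two_category M" "two_category N"
  shows "two_category (two_cat_prod M N)"
proof (rule two_category.intro)
  interpret M: two_category M by fact
  interpret N: two_category N by fact
  have "one_cells_cat (two_cat_prod M N) = cat_prod (one_cells_cat M) (one_cells_cat N)"
    by (simp add: one_cells_cat_def two_cat_prod_def cat_prod_def)
  then show "category (one_cells_cat (two_cat_prod M N))"
    by (simp add: category_cat_prod M.one_cells N.one_cells)
  have "vertical_cat (two_cat_prod M N) = cat_prod (vertical_cat M) (vertical_cat N)"
    by (simp add: vertical_cat_def two_cat_prod_def cat_prod_def)
  then show "category (vertical_cat (two_cat_prod M N))"
    by (simp add: category_cat_prod M.vertical N.vertical)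
  have "horizontal_cat (two_cat_prod M N) = cat_prod (horizontal_cat M) (horizontal_cat N)"
    by (simp add: horizontal_cat_def two_cat_prod_def cat_prod_def fun_eq_iff)
  then show "category (horizontal_cat (two_cat_prod M N))"
    by (simp add: category_cat_prod M.horizontal N.horizontal)
qed (auto simp: two_cat_prod_def
  two_category.src1_globular[OF assms(1)] two_category.src1_globular[OF assms(2)]
  two_category.tgt1_globular[OF assms(1)] two_category.tgt1_globular[OF assms(2)]
  two_category.src2_hcomp2[OF assms(1)] two_category.src2_hcomp2[OF assms(2)]
  two_category.tgt2_hcomp2[OF assms(1)] two_category.tgt2_hcomp2[OF assms(2)]
  two_category.hcomp2_id2[OF assms(1)] two_category.hcomp2_id2[OF assms(2)]
  two_category.interchange[OF assms(1)] two_category.interchange[OF assms(2)])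

lemma two_functor_swap:
  assumes "two_category M" "two_category N"
  shows "two_functor (two_cat_prod M N) (two_cat_prod N M) two_fun_swap"
proof -
  interpret MN: two_category "two_cat_prod M N" by (rule two_category_prod[OF assms])
  interpret NM: two_category "two_cat_prod N M" by (rule two_category_prod[OF assms(2,1)])
  show ?thesis
    by unfold_locales (auto simp: two_cat_prod_def two_fun_swap_def)
qed

lemma (in two_category) src2_Cell1: "a \<in> Cell2 M \<Longrightarrow> src2 M a \<in> Cell1 M"
  using category.Dom_Obj[OF vertical] by (simp add: vertical_cat_def)

lemma two_functor_comp:
  assumes "two_functor M N F" "two_functor N K G"
  shows "two_functor M K (two_fun_comp G F)"
proof -
  interpret F: two_functor M N F by fact
  interpret G: two_functor N K G by fact
  show ?thesis
    by unfold_locales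
      (auto simp: two_fun_comp_def F.map0_Cell0 F.map1_Cell1 F.map2_Cell2 F.map_src1 F.map_tgt1
        F.map_src2 F.map_tgt2 F.map_id1 F.map_id2 F.map_hcomp1 F.map_hcomp2 F.map_vcomp
        two_category.src2_Cell1[OF F.source.two_category_axioms]
        G.map0_Cell0 G.map1_Cell1 G.map2_Cell2 G.map_src1 G.map_tgt1
        G.map_src2 G.map_tgt2 G.map_id1 G.map_id2 G.map_hcomp1 G.map_hcomp2 G.map_vcomp)
qed

section \<open>The 2-category of matrices\<close>

lemma map_mat_eq_iff:
  "map_mat f A = map_mat g B \<longleftrightarrow> dim_row A = dim_row B \<and> dim_col A = dim_col B \<and>
    (\<forall>i<dim_row B. \<forall>j<dim_col B. f (A $$ (i, j)) = g (B $$ (i, j)))"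
proof
  assume eq: "map_mat f A = map_mat g B"
  then have dims: "dim_row A = dim_row B" "dim_col A = dim_col B"
    by (metis index_map_mat(2), metis index_map_mat(3))
  have "f (A $$ (i, j)) = g (B $$ (i, j))" if "i < dim_row B" "j < dim_col B" for i j
    using arg_cong[OF eq, of "\<lambda>X. X $$ (i, j)"] that dims by simp
  with dims show "dim_row A = dim_row B \<and> dim_col A = dim_col B \<and>
    (\<forall>i<dim_row B. \<forall>j<dim_col B. f (A $$ (i, j)) = g (B $$ (i, j)))" by blast
qed (auto intro!: eq_matI)

context strict_symmetric_bimonoidal_category
begin

lemma sum_commute:
  "\<lbrakk>A \<in> Obj C; B \<in> Obj C\<rbrakk> \<Longrightarrow> ten_obj S A B = ten_obj S B A"
  "\<lbrakk>f \<in> Arr C; g \<in> Arr C\<rbrakk> \<Longrightarrow> ten_arr S f g = ten_arr S g f"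
  using additive_symmetry unfolding identity_symmetry_def by blast+

sublocale objects: semiring_on "Obj C" "ten_obj S" "unit_obj S" "ten_obj P" "unit_obj P"
  by (unfold_locales; (rule sum_commute(1); assumption)?)
    (simp_all add: additive.unit_Obj multiplicative.unit_Obj additive.ten_obj_Obj
      multiplicative.ten_obj_Obj additive.ten_obj_assoc multiplicative.ten_obj_assoc
      additive.ten_obj_unit_left multiplicative.ten_obj_unit_left
      multiplicative.ten_obj_unit_right zero_ten_obj ten_zero_obj left_distrib_obj right_distrib_obj)

text \<open>The laws of the two structures are equations between functors, so they hold for morphisms of
  any domains and codomains; composition takes no part in this semiring.\<close>

sublocale arrows: semiring_on "Arr C" "ten_arr S" "Ide C (unit_obj S)" "ten_arr P" "Ide C (unit_obj P)"
  by (unfold_locales; (rule sum_commute(2); assumption)?)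
    (simp_all add: additive.unit_Obj multiplicative.unit_Obj additive.Ide_Arr additive.ten_arr_Arr
      multiplicative.ten_arr_Arr additive.ten_arr_assoc multiplicative.ten_arr_assoc
      additive.ten_arr_unit_left multiplicative.ten_arr_unit_left
      multiplicative.ten_arr_unit_right zero_ten_arr ten_zero_arr left_distrib_arr right_distrib_arr)

sublocale dom: semiring_on_hom "Arr C" "ten_arr S" "Ide C (unit_obj S)" "ten_arr P" "Ide C (unit_obj P)"
    "Obj C" "ten_obj S" "unit_obj S" "ten_obj P" "unit_obj P" "Dom C"
  by unfold_locales
    (simp_all add: additive.Dom_Obj additive.Dom_Ide additive.ten_Dom multiplicative.ten_Dom)

sublocale cod: semiring_on_hom "Arr C" "ten_arr S" "Ide C (unit_obj S)" "ten_arr P" "Ide C (unit_obj P)"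
    "Obj C" "ten_obj S" "unit_obj S" "ten_obj P" "unit_obj P" "Cod C"
  by unfold_locales
    (simp_all add: additive.Cod_Obj additive.Cod_Ide additive.ten_Cod multiplicative.ten_Cod)

sublocale ide: semiring_on_hom "Obj C" "ten_obj S" "unit_obj S" "ten_obj P" "unit_obj P"
    "Arr C" "ten_arr S" "Ide C (unit_obj S)" "ten_arr P" "Ide C (unit_obj P)" "Ide C"
  by unfold_locales
    (simp_all add: additive.Ide_Arr additive.ten_Ide multiplicative.ten_Ide)

text \<open>The dimensions are read off the first factor \<open>a\<close>; those of a vertically composable \<open>b\<close>
  agree.\<close>

abbreviation vertical_composite :: "'a mat \<Rightarrow> 'a mat \<Rightarrow> 'a mat" where
  "vertical_composite b a \<equiv> mat (dim_row a) (dim_col a) (\<lambda>ij. Comp C (b $$ ij) (a $$ ij))"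

text \<open>Functoriality of \<open>\<oplus>\<close>, iterated. The empty sum is the identity of \<open>0\<close>, which is its own
  composite with itself.\<close>

lemma Comp_osum:
  assumes "\<And>j. j < n \<Longrightarrow> f j \<in> Arr C" "\<And>j. j < n \<Longrightarrow> g j \<in> Arr C"
    and "\<And>j. j < n \<Longrightarrow> Dom C (g j) = Cod C (f j)"
  shows "arrows.osum (\<lambda>j. Comp C (g j) (f j)) n = Comp C (arrows.osum g n) (arrows.osum f n)"
  using assms
proof (induction n)
  case 0
  show ?case
    using additive.Comp_Ide[of "Ide C (unit_obj S)"] by (simp add: additive.Dom_Ide)
next
  case (Suc n)
  have "Dom C (arrows.osum g n) = Cod C (arrows.osum f n)"
    using Suc.prems by (simp add: dom.hom_osum cod.hom_osum cong: ordered_sum_cong)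
  then show ?case
    using Suc by (simp add: additive.ten_Comp arrows.osum_closed)
qed

text \<open>The interchange law: functoriality of \<open>\<otimes>\<close> separates the two composites in each summand, and
  functoriality of \<open>\<oplus>\<close> then separates the two sums.\<close>

lemma mprod_vertical_composite:
  assumes "a \<in> arrows.matrices" "a' \<in> arrows.matrices" "b \<in> arrows.matrices" "b' \<in> arrows.matrices"
    and a: "map_mat (Dom C) a' = map_mat (Cod C) a" and b: "map_mat (Dom C) b' = map_mat (Cod C) b"
    and dims: "dim_col b = dim_row a"
  shows "arrows.mprod (vertical_composite b' b) (vertical_composite a' a)
    = vertical_composite (arrows.mprod b' a') (arrows.mprod b a)"
proof (rule eq_matI)
  note a = a[unfolded map_mat_eq_iff] and b = b[unfolded map_mat_eq_iff]
  note cl = arrows.entry_closed[OF assms(1)] arrows.entry_closed[OF assms(2)]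
    arrows.entry_closed[OF assms(3)] arrows.entry_closed[OF assms(4)]
  fix k i
  assume "k < dim_row (vertical_composite (arrows.mprod b' a') (arrows.mprod b a))"
    "i < dim_col (vertical_composite (arrows.mprod b' a') (arrows.mprod b a))"
  then have ki: "k < dim_row b" "i < dim_col a" by (auto simp: matrix_product_def)
  have "arrows.mprod (vertical_composite b' b) (vertical_composite a' a) $$ (k, i)
      = arrows.osum (\<lambda>j. ten_arr P (Comp C (b' $$ (k, j)) (b $$ (k, j)))
          (Comp C (a' $$ (j, i)) (a $$ (j, i)))) (dim_row a)"
    using ki dims by (auto simp: matrix_product_def intro!: ordered_sum_cong)
  also have "\<dots> = arrows.osum (\<lambda>j. Comp C (ten_arr P (b' $$ (k, j)) (a' $$ (j, i)))
          (ten_arr P (b $$ (k, j)) (a $$ (j, i)))) (dim_row a)"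
    using ki a b dims by (intro ordered_sum_cong multiplicative.ten_Comp) (auto simp: cl)
  also have "\<dots> = Comp C
      (arrows.osum (\<lambda>j. ten_arr P (b' $$ (k, j)) (a' $$ (j, i))) (dim_row a))
      (arrows.osum (\<lambda>j. ten_arr P (b $$ (k, j)) (a $$ (j, i))) (dim_row a))"
    using ki a b dims
    by (intro Comp_osum) (auto simp: cl multiplicative.ten_Dom multiplicative.ten_Cod)
  also have "\<dots> = vertical_composite (arrows.mprod b' a') (arrows.mprod b a) $$ (k, i)"
    using ki a b by (simp add: matrix_product_def)
  finally show "arrows.mprod (vertical_composite b' b) (vertical_composite a' a) $$ (k, i)
      = vertical_composite (arrows.mprod b' a') (arrows.mprod b a) $$ (k, i)" .
qed (auto simp: matrix_product_def)

lemma mtensor_vertical_composite: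
  assumes "a \<in> arrows.matrices" "a' \<in> arrows.matrices" "b \<in> arrows.matrices" "b' \<in> arrows.matrices"
    and "map_mat (Dom C) a' = map_mat (Cod C) a" "map_mat (Dom C) b' = map_mat (Cod C) b"
  shows "arrows.mtensor (vertical_composite a' a) (vertical_composite b' b)
    = vertical_composite (arrows.mtensor a' b') (arrows.mtensor a b)"
  using assms
  by (auto simp: matrix_tensor_def map_mat_eq_iff div_mod_bound multiplicative.ten_Comp
      arrows.entry_closed intro!: eq_matI)

lemma category_one_cells: "category (one_cells_cat (Mat C S P))"
  by unfold_locales
    (simp_all add: one_cells_cat_def Mat_def objects.mprod_closed[simplified]
      objects.mprod_assoc objects.mprod_identity objects.identity_matrix_closed[simplified])

lemma category_vertical: "category (vertical_cat (Mat C S P))"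
  by unfold_locales
    (auto simp: vertical_cat_def Mat_def map_mat_eq_iff elements_mat_subset_iff
      additive.Dom_Obj additive.Cod_Obj additive.Ide_Arr additive.Dom_Ide additive.Cod_Ide
      additive.Comp_Arr additive.Dom_Comp additive.Cod_Comp additive.Comp_Ide additive.Ide_Comp
      additive.Comp_assoc intro!: eq_matI)

lemma category_horizontal: "category (horizontal_cat (Mat C S P))"
  by unfold_locales
    (simp_all add: horizontal_cat_def Mat_def arrows.mprod_closed[simplified]
      arrows.mprod_assoc ide.map_mat_identity arrows.mprod_identity arrows.identity_matrix_closed[simplified])

lemma two_category_Mat: "two_category (Mat C S P)"
proof (rule two_category.intro)
  show "category (one_cells_cat (Mat C S P))" by (rule category_one_cells)
  show "category (vertical_cat (Mat C S P))" by (rule category_vertical)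
  show "category (horizontal_cat (Mat C S P))" by (rule category_horizontal)
  fix a a' b b'
  assume "a \<in> Cell2 (Mat C S P)" "a' \<in> Cell2 (Mat C S P)" "b \<in> Cell2 (Mat C S P)"
    "b' \<in> Cell2 (Mat C S P)" "src2 (Mat C S P) a' = tgt2 (Mat C S P) a"
    "src2 (Mat C S P) b' = tgt2 (Mat C S P) b"
    "src1 (Mat C S P) (src2 (Mat C S P) b) = tgt1 (Mat C S P) (src2 (Mat C S P) a)"
  then show "hcomp2 (Mat C S P) (vcomp (Mat C S P) b' b) (vcomp (Mat C S P) a' a)
      = vcomp (Mat C S P) (hcomp2 (Mat C S P) b' a') (hcomp2 (Mat C S P) b a)"
    using mprod_vertical_composite[of a a' b b'] by (simp add: Mat_def)
qed (simp_all add: Mat_def dom.map_mat_mprod cod.map_mat_mprod ide.map_mat_mprod)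

end

section \<open>The permutative structure\<close>

locale commutative_bimonoidal_category = strict_symmetric_bimonoidal_category +
  assumes multiplicative_symmetry: "identity_symmetry C P"
begin

lemma product_commute:
  "\<lbrakk>A \<in> Obj C; B \<in> Obj C\<rbrakk> \<Longrightarrow> ten_obj P A B = ten_obj P B A"
  "\<lbrakk>f \<in> Arr C; g \<in> Arr C\<rbrakk> \<Longrightarrow> ten_arr P f g = ten_arr P g f"
  using multiplicative_symmetry unfolding identity_symmetry_def by blast+

sublocale objects: comm_semiring_on "Obj C" "ten_obj S" "unit_obj S" "ten_obj P" "unit_obj P"
  by unfold_locales (rule product_commute)

sublocale arrows: comm_semiring_on "Arr C" "ten_arr S" "Ide C (unit_obj S)" "ten_arr P" "Ide C (unit_obj P)"
  by unfold_locales (rule product_commute)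

lemma two_functor_Mat_tensor:
  "two_functor (two_cat_prod (Mat C S P) (Mat C S P)) (Mat C S P) (Mat_tensor P)"
proof (intro two_functor.intro two_functor_axioms.intro two_category_prod two_category_Mat)
qed (simp_all add: mem_Times_iff case_prod_beta prod_eq_iff two_cat_prod_def Mat_def Mat_tensor_def
    objects.mtensor_closed[simplified] arrows.mtensor_closed[simplified]
    dom.map_mat_mtensor cod.map_mat_mtensor ide.map_mat_mtensor
    objects.mtensor_identity objects.mtensor_mprod arrows.mtensor_mprod mtensor_vertical_composite)

lemma two_functor_Mat_tensor_swap:
  "two_functor (two_cat_prod (Mat C S P) (Mat C S P)) (Mat C S P)
    (two_fun_comp (Mat_tensor P) two_fun_swap)"
  by (rule two_functor_comp[OF two_functor_swap[OF two_category_Mat two_category_Mat]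
      two_functor_Mat_tensor])

lemma two_natural_Mat_symmetry:
  "two_natural_transformation (two_cat_prod (Mat C S P) (Mat C S P)) (Mat C S P)
    (Mat_tensor P) (two_fun_comp (Mat_tensor P) two_fun_swap) (Mat_symmetry S P)"
proof (intro two_natural_transformation.intro two_natural_transformation_axioms.intro
    two_functor_Mat_tensor two_functor_Mat_tensor_swap)
qed (simp_all add: mem_Times_iff case_prod_beta prod.swap_def two_cat_prod_def Mat_def Mat_tensor_def two_fun_comp_def two_fun_swap_def
    Mat_symmetry_def objects.transposition_closed[simplified] objects.transposition_natural
    ide.map_mat_transposition arrows.transposition_natural)

text \<open>The inverse of \<open>\<beta>\<^sub>m\<^sub>n\<close> is \<open>\<beta>\<^sub>n\<^sub>m\<close>, and its naturality at \<open>(A, B)\<close> is that of \<open>\<beta>\<close> at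
  \<open>(B, A)\<close>.\<close>

lemma two_natural_Mat_symmetry_inverse:
  "two_natural_transformation (two_cat_prod (Mat C S P) (Mat C S P)) (Mat C S P)
    (two_fun_comp (Mat_tensor P) two_fun_swap) (Mat_tensor P) (Mat_symmetry S P \<circ> prod.swap)"
proof (intro two_natural_transformation.intro two_natural_transformation_axioms.intro
    two_functor_Mat_tensor two_functor_Mat_tensor_swap)
qed (simp_all add: mem_Times_iff case_prod_beta prod.swap_def two_cat_prod_def Mat_def Mat_tensor_def two_fun_comp_def two_fun_swap_def
    Mat_symmetry_def objects.transposition_closed[simplified] objects.transposition_natural
    ide.map_mat_transposition arrows.transposition_natural)

lemma two_natural_isomorphism_Mat_symmetry:
  "two_natural_isomorphism (two_cat_prod (Mat C S P) (Mat C S P)) (Mat C S P)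
    (Mat_tensor P) (two_fun_comp (Mat_tensor P) two_fun_swap) (Mat_symmetry S P)"
  unfolding two_natural_isomorphism_def
  by (intro conjI two_natural_Mat_symmetry exI[of _ "Mat_symmetry S P \<circ> prod.swap"]
      two_natural_Mat_symmetry_inverse)
    (auto simp: two_cat_prod_def Mat_def Mat_tensor_def two_fun_comp_def two_fun_swap_def
      Mat_symmetry_def objects.transposition_involutive)

lemma monoid_Mat: "monoid_two_category (Mat C S P) (Mat_tensor P) 1"
proof (intro monoid_two_category.intro monoid_two_category_axioms.intro two_category_Mat
    two_functor_Mat_tensor)
qed (auto simp: two_fun_eq_on_def two_cat_prod_def Mat_def Mat_tensor_def two_fun_comp_def
    two_fun_prod_def two_fun_id_def two_fun_assoc_def two_fun_pair_left_def two_fun_pair_right_def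
    objects.mtensor_assoc arrows.mtensor_assoc ide.map_mat_identity
    objects.mtensor_unit[simplified] arrows.mtensor_unit[simplified])

lemma permutative_Mat:
  "permutative_two_category (Mat C S P) (Mat_tensor P) 1 (Mat_symmetry S P)"
proof (intro permutative_two_category.intro permutative_two_category_axioms.intro monoid_Mat
    two_natural_isomorphism_Mat_symmetry)
qed (simp_all add: Mat_def Mat_tensor_def Mat_symmetry_def objects.transposition_unit[simplified]
    objects.transposition_involutive objects.transposition_product)

end

theorem theoremI9p4p2:
  fixes C :: "('o, 'a) cat"
    and S P :: "('o, 'a) perm_structure"
  assumes "strict_symmetric_bimonoidal_category C S P"
    and "identity_symmetry C P"
  shows "permutative_two_category (Mat C S P) (Mat_tensor P) 1 (Mat_symmetry S P)"
  by (rule commutative_bimonoidal_category.permutative_Mat,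
      rule commutative_bimonoidal_category.intro[OF assms(1)],
      rule commutative_bimonoidal_category_axioms.intro[OF assms(2)])

end
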